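(* For the graph $P_n^2$ with $n \geq 3$, $$\chi'_{\mathrm{star}}(P_{n}^{2})= \begin{cases} 3, & n = 3;\\ 4, & n = 4;\\ 6, & n \geq 5. \end{cases}$$
   Context: All graphs are simple, finite and undirected. $P_n = v_1v_2\dots v_n$ is the path on $n$ vertices, and $P_n^2$ is its square: the graph on the same vertex set in which two distinct vertices are adjacent if and only if their distance in $P_n$ is at most $2$. A star $k$-edge-coloring of a graph $G$ is a proper edge-coloring of $G$ with $k$ colors such that no path of length four and no cycle of length four in $G$ (length = number of edges) is bicolored, i.e., at least three colors appear on every path or cycle of length four. The star chromatic index $\chi_{\mathrm{star}}'(G)$ is the smallest $k$ such that $G$ has a star $k$-edge-coloring. *)

theory Defs
  imports Main "HOL-Library.Extended_Nat"
begin

record 'a ugraph =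
  verts :: "'a set"
  edges :: "'a set set"

definition simple_graph :: "'a ugraph \<Rightarrow> bool" where
  "simple_graph G \<longleftrightarrow>
     finite (verts G) \<and> edges G \<subseteq> {e. e \<subseteq> verts G \<and> card e = 2}"

text \<open>Walks, paths and cycles are given by their vertex sequences. A cycle
  lists each of its vertices once, and its closing edge joins the last vertex to the first.\<close>

definition walk :: "'a ugraph \<Rightarrow> 'a list \<Rightarrow> bool" where
  "walk G p \<longleftrightarrow>
     p \<noteq> [] \<and> set p \<subseteq> verts G \<and> successively (\<lambda>u v. {u, v} \<in> edges G) p"

definition walk_edges :: "'a list \<Rightarrow> 'a set set" where
  "walk_edges p = (\<lambda>(u, v). {u, v}) ` set (zip p (tl p))"

definition walk_length :: "'a list \<Rightarrow> nat" where
  "walk_length p = length p - 1"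

definition path :: "'a ugraph \<Rightarrow> 'a list \<Rightarrow> bool" where
  "path G p \<longleftrightarrow> walk G p \<and> distinct p"

definition cycle :: "'a ugraph \<Rightarrow> 'a list \<Rightarrow> bool" where
  "cycle G p \<longleftrightarrow> path G p \<and> length p \<ge> 3 \<and> {last p, hd p} \<in> edges G"

definition cycle_edges :: "'a list \<Rightarrow> 'a set set" where
  "cycle_edges p = insert {last p, hd p} (walk_edges p)"

text \<open>The distance is infinite for vertices that are not joined by a walk.\<close>

definition distance :: "'a ugraph \<Rightarrow> 'a \<Rightarrow> 'a \<Rightarrow> enat" where
  "distance G u v =
     (INF p \<in> {p. walk G p \<and> hd p = u \<and> last p = v}. enat (walk_length p))"

definition graph_square :: "'a ugraph \<Rightarrow> 'a ugraph" where
  "graph_square G =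
     \<lparr>verts = verts G,
      edges = {{u, v} | u v. u \<in> verts G \<and> v \<in> verts G \<and> u \<noteq> v \<and> distance G u v \<le> 2}\<rparr>"

definition path_graph :: "nat \<Rightarrow> nat ugraph" where
  "path_graph n = \<lparr>verts = {1..n}, edges = {{i, Suc i} | i. 1 \<le> i \<and> i < n}\<rparr>"

definition proper_edge_coloring :: "'a ugraph \<Rightarrow> ('a set \<Rightarrow> nat) \<Rightarrow> bool" where
  "proper_edge_coloring G c \<longleftrightarrow>
     (\<forall>e \<in> edges G. \<forall>f \<in> edges G. e \<noteq> f \<and> e \<inter> f \<noteq> {} \<longrightarrow> c e \<noteq> c f)"

definition star_edge_coloring :: "'a ugraph \<Rightarrow> nat \<Rightarrow> ('a set \<Rightarrow> nat) \<Rightarrow> bool" where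
  "star_edge_coloring G k c \<longleftrightarrow>
     c ` edges G \<subseteq> {..<k} \<and>
     proper_edge_coloring G c \<and>
     (\<forall>p. path G p \<and> walk_length p = 4 \<longrightarrow> card (c ` walk_edges p) \<ge> 3) \<and>
     (\<forall>p. cycle G p \<and> length p = 4 \<longrightarrow> card (c ` cycle_edges p) \<ge> 3)"

text \<open>For a finite simple graph such a number of colors exists, since giving
  pairwise distinct colors to all edges is a star edge-coloring.\<close>

definition star_chromatic_index :: "'a ugraph \<Rightarrow> nat" where
  "star_chromatic_index G = (LEAST k. \<exists>c. star_edge_coloring G k c)"

lemma simple_graph_path_graph: "simple_graph (path_graph n)"
  by (auto simp: simple_graph_def path_graph_def)

lemma simple_graph_square: "simple_graph G \<Longrightarrow> simple_graph (graph_square G)"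
  by (auto simp: simple_graph_def graph_square_def)

end

theory Submission
  imports Defs
begin

text \<open>
  In the square of the path the adjacent vertices are those whose numbers differ by \<open>1\<close> or \<open>2\<close>.
  For a proper colouring, the star condition says that no trail \<open>u v w x y\<close>, where \<open>y\<close> may
  return to \<open>u\<close>, has colours of the form \<open>a b a b\<close> (\<open>star_edge_coloring_iff\<close>). Both the
  four-edge paths and the four-cycles are covered by this one condition.

  \<^bold>\<open>Lower bounds.\<close> A triangle needs three colours. With three colours on four vertices, the
  triangle \<open>1 2 3\<close> forces \<open>34\<close> to repeat the colour of \<open>12\<close> and \<open>24\<close> that of \<open>13\<close>, so the cycle
  \<open>1 2 4 3\<close> is bicoloured. On five vertices the four edges at vertex \<open>3\<close> have distinct colours;
  a fifth colour leaves so little choice for \<open>12\<close>, \<open>24\<close>, \<open>45\<close> that there is always a bicoloured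
  trail (\<open>five_vertices_need_six_colors\<close>). Longer paths contain this configuration.

  \<^bold>\<open>Upper bounds.\<close> For three and four vertices, the colour of \<open>uv\<close> is \<open>u + v\<close> modulo the number
  of vertices. For six colours and any length, view the graph as the part from
  \<open>1\<close> to \<open>n\<close> of a triangulated ladder whose rung number \<open>j\<close> joins \<open>2j\<close> and \<open>2j + 1\<close>. Rungs
  alternate between the colours \<open>4\<close> and \<open>5\<close>. Between the rungs \<open>j\<close> and \<open>j + 1\<close>, in layer \<open>j\<close>, both
  rails have colour \<open>j mod 4\<close>, and the diagonal \<open>(2j + 1, 2j + 2)\<close> has colour \<open>(j + 2) mod 4\<close>.
  Two edges of the same colour that are joined by an edge are then either
  the two rails of one layer, or a rail and a diagonal two layers apart that lie on a monotone
  trail (\<open>ladder_color_eq_joined\<close>). A trail coloured \<open>a b a b\<close> would need this twice in a row.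
  Two rails of one layer cannot occur: the edge between them is a rung or the diagonal of this layer,
  so it is no rail, and after it a monotone trail would go on to the next layer. So the trail is
  monotone and contains two diagonals. But on a rising trail, each diagonal leads from the odd rail
  to the even rail, and nothing leads back.
\<close>

section \<open>The edges of the square of a path\<close>

abbreviation near :: "nat \<Rightarrow> nat \<Rightarrow> bool" where
  "near u v \<equiv> u \<noteq> v \<and> u \<le> v + 2 \<and> v \<le> u + 2"

text \<open>The infimum that defines the distance is attained, because it is taken in a well-order.\<close>

lemma distance_le_enat_iff:
  "distance G u v \<le> enat m \<longleftrightarrow> (\<exists>p. walk G p \<and> hd p = u \<and> last p = v \<and> walk_length p \<le> m)"
proof -
  have "distance G u v \<le> enat m \<longleftrightarrow> distance G u v < enat (Suc m)"
    by (metis Suc_ile_eq eSuc_enat ileI1 iless_Suc_eq not_le)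
  then show ?thesis
    by (auto simp: distance_def INF_less_iff less_Suc_eq_le)
qed

lemma edge_path_graph_iff:
  "{u, v} \<in> edges (path_graph n) \<longleftrightarrow>
     u \<in> {1..n} \<and> v \<in> {1..n} \<and> (v = Suc u \<or> u = Suc v)"
  by (auto simp: path_graph_def doubleton_eq_iff)

text \<open>A walk in the path changes the vertex number by one at each step.\<close>

lemma walk_path_graph_bound:
  assumes "walk (path_graph n) p"
  shows "hd p \<le> last p + walk_length p \<and> last p \<le> hd p + walk_length p"
proof -
  have "p \<noteq> []" "successively (\<lambda>u v. {u, v} \<in> edges (path_graph n)) p"
    using assms by (auto simp: walk_def)
  then show ?thesis
  proof (induction p rule: induct_list012)
    case (3 x y zs)
    then show ?case
      by (auto simp: walk_length_def edge_path_graph_iff)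
  qed (auto simp: walk_length_def)
qed

lemma edge_square_path_iff:
  "{u, v} \<in> edges (graph_square (path_graph n)) \<longleftrightarrow>
     u \<in> {1..n} \<and> v \<in> {1..n} \<and> near u v" (is "_ \<longleftrightarrow> ?near")
proof -
  let ?G = "path_graph n"
  have V: "verts ?G = {1..n}" by (simp add: path_graph_def)
  have two: "(2::enat) = enat 2" by (simp add: numeral_eq_enat)
  have key: "distance ?G u v \<le> 2 \<longleftrightarrow> u \<le> v + 2 \<and> v \<le> u + 2"
    if uv: "u \<in> {1..n}" "v \<in> {1..n}" "u \<noteq> v" for u v
  proof
    assume "distance ?G u v \<le> 2"
    then obtain p where "walk ?G p" "hd p = u" "last p = v" "walk_length p \<le> 2"
      unfolding two distance_le_enat_iff by blast
    then show "u \<le> v + 2 \<and> v \<le> u + 2"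
      using walk_path_graph_bound[of n p] by auto
  next
    assume "u \<le> v + 2 \<and> v \<le> u + 2"
    then consider "v = u + 1" | "u = v + 1" | "v = u + 2" | "u = v + 2"
      using uv by linarith
    then have "\<exists>p. walk ?G p \<and> hd p = u \<and> last p = v \<and> walk_length p \<le> 2"
    proof cases
      case 1
      then show ?thesis using uv
        by (intro exI[of _ "[u, v]"]) (auto simp: walk_def V edge_path_graph_iff walk_length_def)
    next
      case 2
      then show ?thesis using uv
        by (intro exI[of _ "[u, v]"]) (auto simp: walk_def V edge_path_graph_iff walk_length_def)
    next
      case 3
      then show ?thesis using uv
        by (intro exI[of _ "[u, u + 1, v]"]) (auto simp: walk_def V edge_path_graph_iff walk_length_def)
    next
      case 4
      then show ?thesis using uv
        by (intro exI[of _ "[u, v + 1, v]"]) (auto simp: walk_def V edge_path_graph_iff walk_length_def)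
    qed
    then show "distance ?G u v \<le> 2"
      unfolding two distance_le_enat_iff .
  qed
  show ?thesis
  proof
    assume "{u, v} \<in> edges (graph_square ?G)"
    then obtain x y where "{u, v} = {x, y}" and
      xy: "x \<in> {1..n}" "y \<in> {1..n}" "x \<noteq> y" "distance ?G x y \<le> 2"
      by (auto simp: graph_square_def V)
    then have "u = x \<and> v = y \<or> u = y \<and> v = x"
      by (simp add: doubleton_eq_iff)
    moreover have "x \<le> y + 2 \<and> y \<le> x + 2"
      using key xy by blast
    ultimately show ?near using xy by blast
  next
    assume near: ?near
    then have "distance ?G u v \<le> 2" using key by blast
    with near show "{u, v} \<in> edges (graph_square ?G)"
      by (simp add: graph_square_def V) blast
  qed
qed

section \<open>Star edge-colourings without bicoloured trails\<close>

lemma edge_pairE: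
  assumes "simple_graph G" "e \<in> edges G"
  obtains u v where "e = {u, v}"
  using assms by (auto simp: simple_graph_def card_2_iff)

lemma proper_edge_coloring_iff:
  assumes G: "simple_graph G"
  shows "proper_edge_coloring G c \<longleftrightarrow>
    (\<forall>u v w. {u, v} \<in> edges G \<and> {v, w} \<in> edges G \<and> u \<noteq> w \<longrightarrow> c {u, v} \<noteq> c {v, w})"
    (is "_ \<longleftrightarrow> ?adj")
proof
  assume c: "proper_edge_coloring G c"
  show ?adj
  proof (intro allI impI, elim conjE)
    fix u v w assume e: "{u, v} \<in> edges G" "{v, w} \<in> edges G" "u \<noteq> w"
    then have "{u, v} \<noteq> {v, w}" by (auto simp: doubleton_eq_iff)
    moreover have "{u, v} \<inter> {v, w} \<noteq> {}" by simp
    ultimately show "c {u, v} \<noteq> c {v, w}"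
      using c e(1,2) unfolding proper_edge_coloring_def by metis
  qed
next
  assume adj: ?adj
  show "proper_edge_coloring G c"
    unfolding proper_edge_coloring_def
  proof (intro ballI impI, elim conjE)
    fix e f assume ef: "e \<in> edges G" "f \<in> edges G" "e \<noteq> f" "e \<inter> f \<noteq> {}"
    then obtain v where v: "v \<in> e" "v \<in> f" by blast
    obtain u where u: "e = {u, v}"
      using edge_pairE[OF G ef(1)] v(1) by (metis insert_commute insert_iff singletonD)
    obtain w where w: "f = {v, w}"
      using edge_pairE[OF G ef(2)] v(2) by (metis insert_commute insert_iff singletonD)
    have "u \<noteq> w" using ef(3) u w by auto
    with adj ef(1,2) show "c e \<noteq> c f" unfolding u w by blast
  qed
qed

text \<open>Four consecutive colours, of which neighbouring ones differ, take at least three values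
  unless they have the form \<open>a b a b\<close>. The last vertex \<open>y\<close> may be \<open>u\<close>; this is the case of
  a four-cycle.\<close>

lemma star_edge_coloring_iff:
  assumes G: "simple_graph G"
  shows "star_edge_coloring G k c \<longleftrightarrow>
    c ` edges G \<subseteq> {..<k} \<and> proper_edge_coloring G c \<and>
    (\<forall>u v w x y. {u, v} \<in> edges G \<and> {v, w} \<in> edges G \<and> {w, x} \<in> edges G \<and> {x, y} \<in> edges G \<and>
       distinct [u, v, w, x] \<and> y \<notin> {v, w, x} \<longrightarrow>
       \<not> (c {u, v} = c {w, x} \<and> c {v, w} = c {x, y}))"
    (is "_ \<longleftrightarrow> _ \<and> _ \<and> ?noalt")
proof -
  have inV: "a \<in> verts G" "b \<in> verts G" if "{a, b} \<in> edges G" for a b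
    using G that by (auto simp: simple_graph_def)
  have path5: "(\<forall>p. path G p \<and> walk_length p = 4 \<longrightarrow> P p) \<longleftrightarrow>
      (\<forall>u v w x y. {u, v} \<in> edges G \<and> {v, w} \<in> edges G \<and> {w, x} \<in> edges G \<and> {x, y} \<in> edges G \<and>
         distinct [u, v, w, x, y] \<longrightarrow> P [u, v, w, x, y])" (is "?L \<longleftrightarrow> ?R") for P
  proof
    assume ?L
    show ?R
    proof (intro allI impI)
      fix u v w x y
      assume e: "{u, v} \<in> edges G \<and> {v, w} \<in> edges G \<and> {w, x} \<in> edges G \<and> {x, y} \<in> edges G \<and>
        distinct [u, v, w, x, y]"
      with spec[OF \<open>?L\<close>, of "[u, v, w, x, y]"] show "P [u, v, w, x, y]"
        using inV by (auto simp: path_def walk_def walk_length_def)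
    qed
  next
    assume R: ?R
    show ?L
    proof (intro allI impI)
      fix p assume p: "path G p \<and> walk_length p = 4"
      then have "length p = Suc (Suc (Suc (Suc (Suc 0))))"
        unfolding walk_length_def by linarith
      then obtain u v w x y where "p = [u, v, w, x, y]"
        by (auto simp: length_Suc_conv)
      with p R show "P p" by (simp add: path_def walk_def)
    qed
  qed
  have cycle4: "(\<forall>p. cycle G p \<and> length p = 4 \<longrightarrow> P p) \<longleftrightarrow>
      (\<forall>u v w x. {u, v} \<in> edges G \<and> {v, w} \<in> edges G \<and> {w, x} \<in> edges G \<and> {x, u} \<in> edges G \<and>
         distinct [u, v, w, x] \<longrightarrow> P [u, v, w, x])" (is "?L \<longleftrightarrow> ?R") for P
  proof
    assume ?L
    show ?R
    proof (intro allI impI)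
      fix u v w x
      assume e: "{u, v} \<in> edges G \<and> {v, w} \<in> edges G \<and> {w, x} \<in> edges G \<and> {x, u} \<in> edges G \<and>
        distinct [u, v, w, x]"
      with spec[OF \<open>?L\<close>, of "[u, v, w, x]"] show "P [u, v, w, x]"
        using inV by (auto simp: cycle_def path_def walk_def)
    qed
  next
    assume R: ?R
    show ?L
    proof (intro allI impI)
      fix p assume p: "cycle G p \<and> length p = 4"
      then have "length p = Suc (Suc (Suc (Suc 0)))" by simp
      then obtain u v w x where "p = [u, v, w, x]"
        by (auto simp: length_Suc_conv)
      with p R show "P p" by (simp add: cycle_def path_def walk_def)
    qed
  qed
  have three: "3 \<le> card {c1, c2, c3, c4} \<longleftrightarrow> \<not> (c1 = c3 \<and> c2 = c4)"
    if "c1 \<noteq> c2" "c2 \<noteq> c3" "c3 \<noteq> c4" for c1 c2 c3 c4 :: nat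
    using that by (auto simp: card_insert_if)
  show ?thesis
  proof (cases "proper_edge_coloring G c")
    case True
    have adj: "c {a, b} \<noteq> c {b, d}" if "{a, b} \<in> edges G" "{b, d} \<in> edges G" "a \<noteq> d" for a b d
      using True that unfolding proper_edge_coloring_iff[OF G] by blast
    have paths: "card (c ` walk_edges [u, v, w, x, y]) \<ge> 3 \<longleftrightarrow>
        \<not> (c {u, v} = c {w, x} \<and> c {v, w} = c {x, y})"
      if "{u, v} \<in> edges G" "{v, w} \<in> edges G" "{w, x} \<in> edges G" "{x, y} \<in> edges G"
        "distinct [u, v, w, x, y]" for u v w x y
    proof -
      have "c ` walk_edges [u, v, w, x, y] = {c {u, v}, c {v, w}, c {w, x}, c {x, y}}"
        by (simp add: walk_edges_def)
      then show ?thesis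
        using that three[of "c {u, v}" "c {v, w}" "c {w, x}" "c {x, y}"]
          adj[of u v w] adj[of v w x] adj[of w x y]
        by simp
    qed
    have cycles: "card (c ` cycle_edges [u, v, w, x]) \<ge> 3 \<longleftrightarrow>
        \<not> (c {u, v} = c {w, x} \<and> c {v, w} = c {x, u})"
      if "{u, v} \<in> edges G" "{v, w} \<in> edges G" "{w, x} \<in> edges G" "{x, u} \<in> edges G"
        "distinct [u, v, w, x]" for u v w x
    proof -
      have "c ` cycle_edges [u, v, w, x] = {c {u, v}, c {v, w}, c {w, x}, c {x, u}}"
        by (auto simp: walk_edges_def cycle_edges_def)
      then show ?thesis
        using that three[of "c {u, v}" "c {v, w}" "c {w, x}" "c {x, u}"]
          adj[of u v w] adj[of v w x] adj[of w x u]
        by (smt (verit) distinct_length_2_or_more)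
    qed
    have "?noalt \<longleftrightarrow>
       (\<forall>p. path G p \<and> walk_length p = 4 \<longrightarrow> card (c ` walk_edges p) \<ge> 3) \<and>
       (\<forall>p. cycle G p \<and> length p = 4 \<longrightarrow> card (c ` cycle_edges p) \<ge> 3)" (is "_ \<longleftrightarrow> ?star")
    proof
      assume na: ?noalt
      show ?star unfolding path5 cycle4
      proof (intro conjI allI impI, goal_cases)
        case (1 u v w x y)
        then show ?case using na[rule_format, of u v w x y] paths[of u v w x y] by auto
      next
        case (2 u v w x)
        then show ?case using na[rule_format, of u v w x u] cycles[of u v w x] by auto
      qed
    next
      assume s: ?star
      show ?noalt
      proof (intro allI impI)
        fix u v w x y
        assume e: "{u, v} \<in> edges G \<and> {v, w} \<in> edges G \<and> {w, x} \<in> edges G \<and> {x, y} \<in> edges G \<and>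
          distinct [u, v, w, x] \<and> y \<notin> {v, w, x}"
        show "\<not> (c {u, v} = c {w, x} \<and> c {v, w} = c {x, y})"
        proof (cases "y = u")
          case True
          then show ?thesis using s e cycles[of u v w x] unfolding path5 cycle4 by auto
        next
          case False
          then show ?thesis using s e paths[of u v w x y] unfolding path5 cycle4 by auto
        qed
      qed
    qed
    then show ?thesis unfolding star_edge_coloring_def using True by blast
  qed (simp add: star_edge_coloring_def)
qed

lemma star_edge_coloring_square_path_iff:
  "star_edge_coloring (graph_square (path_graph n)) k c \<longleftrightarrow>
     (\<forall>u v. {u, v} \<subseteq> {1..n} \<and> near u v \<longrightarrow> c {u, v} < k) \<and>
     (\<forall>u v w. {u, v, w} \<subseteq> {1..n} \<and> near u v \<and> near v w \<and> u \<noteq> w \<longrightarrow> c {u, v} \<noteq> c {v, w}) \<and>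
     (\<forall>u v w x y. {u, v, w, x, y} \<subseteq> {1..n} \<and> near u v \<and> near v w \<and> near w x \<and> near x y \<and>
        distinct [u, v, w, x] \<and> y \<notin> {v, w, x} \<longrightarrow>
        \<not> (c {u, v} = c {w, x} \<and> c {v, w} = c {x, y}))"
proof -
  let ?G = "graph_square (path_graph n)"
  have G: "simple_graph ?G"
    by (intro simple_graph_square simple_graph_path_graph)
  have "c ` edges ?G \<subseteq> {..<k} \<longleftrightarrow> (\<forall>u v. {u, v} \<in> edges ?G \<longrightarrow> c {u, v} < k)"
  proof
    assume small: "\<forall>u v. {u, v} \<in> edges ?G \<longrightarrow> c {u, v} < k"
    have "c e < k" if e: "e \<in> edges ?G" for e
    proof -
      obtain u v where uv: "e = {u, v}" using edge_pairE[OF G e] .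
      show ?thesis using e small unfolding uv by blast
    qed
    then show "c ` edges ?G \<subseteq> {..<k}" by blast
  qed blast
  then show ?thesis
    unfolding star_edge_coloring_iff[OF G] proper_edge_coloring_iff[OF G] edge_square_path_iff
    by (simp add: conj_ac)
qed

lemma star_edge_coloring_mono:
  "star_edge_coloring G k c \<Longrightarrow> k \<le> k' \<Longrightarrow> star_edge_coloring G k' c"
  using subset_trans[of "c ` edges G" "{..<k}" "{..<k'}"] by (simp add: star_edge_coloring_def)

section \<open>Lower bounds\<close>

lemma triangle_needs_three_colors:
  assumes n: "n \<ge> 3" and c: "star_edge_coloring (graph_square (path_graph n)) k c"
  shows "k \<ge> 3"
proof -
  have lt: "c {u, v} < k" if "{u, v} \<subseteq> {1..n}" "near u v" for u v
    using c that unfolding star_edge_coloring_square_path_iff by blast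
  have adj: "c {u, v} \<noteq> c {v, w}"
    if "{u, v, w} \<subseteq> {1..n}" "near u v" "near v w" "u \<noteq> w" for u v w
    using c that unfolding star_edge_coloring_square_path_iff by blast
  have "c {1, 2} < k" "c {1, 3} < k" "c {2, 3} < k"
    using n by (auto intro!: lt)
  moreover have "c {1, 2} \<noteq> c {1, 3}" "c {1, 2} \<noteq> c {2, 3}" "c {1, 3} \<noteq> c {2, 3}"
    using n adj[of 2 1 3] adj[of 1 2 3] adj[of 1 3 2] by (simp_all add: insert_commute)
  ultimately show ?thesis by linarith
qed

lemma four_vertices_need_four_colors:
  assumes n: "n \<ge> 4" and c: "star_edge_coloring (graph_square (path_graph n)) k c"
  shows "k \<ge> 4"
proof (rule ccontr)
  assume "\<not> k \<ge> 4"
  then have c3: "star_edge_coloring (graph_square (path_graph n)) 3 c"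
    using star_edge_coloring_mono[OF c] by simp
  have lt: "c {u, v} < 3" if "{u, v} \<subseteq> {1..n}" "near u v" for u v
    using c3 that unfolding star_edge_coloring_square_path_iff by blast
  have adj: "c {u, v} \<noteq> c {v, w}"
    if "{u, v, w} \<subseteq> {1..n}" "near u v" "near v w" "u \<noteq> w" for u v w
    using c3 that unfolding star_edge_coloring_square_path_iff by blast
  have alt: "\<not> (c {u, v} = c {w, x} \<and> c {v, w} = c {x, y})"
    if "{u, v, w, x, y} \<subseteq> {1..n}" "near u v" "near v w" "near w x" "near x y"
      "distinct [u, v, w, x]" "y \<notin> {v, w, x}" for u v w x y
    using c3 that unfolding star_edge_coloring_square_path_iff by blast
  have "c {1, 2} < 3" "c {1, 3} < 3" "c {2, 3} < 3" "c {2, 4} < 3" "c {3, 4} < 3"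
    using n by (auto intro!: lt)
  moreover have "c {1, 2} \<noteq> c {1, 3}" "c {1, 2} \<noteq> c {2, 3}" "c {1, 3} \<noteq> c {2, 3}"
    using n adj[of 2 1 3] adj[of 1 2 3] adj[of 1 3 2] by (simp_all add: insert_commute)
  moreover have "c {1, 3} \<noteq> c {3, 4}" "c {2, 3} \<noteq> c {3, 4}" "c {1, 2} \<noteq> c {2, 4}" "c {2, 3} \<noteq> c {2, 4}"
    using n adj[of 1 3 4] adj[of 2 3 4] adj[of 1 2 4] adj[of 3 2 4] by (simp_all add: insert_commute)
  ultimately have "c {1, 2} = c {3, 4}" "c {1, 3} = c {2, 4}" by linarith+
  then show False
    using n alt[of 1 2 4 3 1] by (simp add: insert_commute)
qed

text \<open>Let \<open>A, B, C, D\<close> be the colours of \<open>13, 23, 34, 35\<close> and \<open>E\<close> the fifth colour. The edge \<open>24\<close>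
  meets \<open>B\<close> and \<open>C\<close>. If it has colour \<open>E\<close>, then \<open>12\<close> is coloured \<open>C\<close> or \<open>D\<close> and \<open>45\<close> is coloured
  \<open>A\<close> or \<open>B\<close>, and each combination gives a bicoloured path. If it has colour \<open>A\<close>, then \<open>45\<close>
  must be \<open>E\<close>, and no colour remains for \<open>12\<close>. The colour \<open>D\<close> is the mirror image.\<close>

lemma five_vertices_need_six_colors:
  assumes n: "n \<ge> 5" and c: "star_edge_coloring (graph_square (path_graph n)) k c"
  shows "k \<ge> 6"
proof (rule ccontr)
  assume "\<not> k \<ge> 6"
  then have c5: "star_edge_coloring (graph_square (path_graph n)) 5 c"
    using star_edge_coloring_mono[OF c] by simp
  have lt: "c {u, v} < 5" if "{u, v} \<subseteq> {1..n}" "near u v" for u v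
    using c5 that unfolding star_edge_coloring_square_path_iff by blast
  have adj: "c {u, v} \<noteq> c {v, w}"
    if "{u, v, w} \<subseteq> {1..n}" "near u v" "near v w" "u \<noteq> w" for u v w
    using c5 that unfolding star_edge_coloring_square_path_iff by blast
  have alt: "\<not> (c {u, v} = c {w, x} \<and> c {v, w} = c {x, y})"
    if "{u, v, w, x, y} \<subseteq> {1..n}" "near u v" "near v w" "near w x" "near x y"
      "distinct [u, v, w, x]" "y \<notin> {v, w, x}" for u v w x y
    using c5 that unfolding star_edge_coloring_square_path_iff by blast
  define A B C D p q r where col: "A = c {1, 3}" "B = c {2, 3}" "C = c {3, 4}" "D = c {3, 5}"
    "p = c {1, 2}" "q = c {2, 4}" "r = c {4, 5}"
  have lt5: "A < 5" "B < 5" "C < 5" "D < 5" "p < 5" "q < 5" "r < 5"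
    unfolding col using n by (auto intro!: lt)
  have ABCD: "A \<noteq> B" "A \<noteq> C" "A \<noteq> D" "B \<noteq> C" "B \<noteq> D" "C \<noteq> D"
    unfolding col
    using n adj[of 1 3 2] adj[of 1 3 4] adj[of 1 3 5] adj[of 2 3 4] adj[of 2 3 5] adj[of 4 3 5]
    by (simp_all add: insert_commute)
  have pqr: "p \<noteq> A" "p \<noteq> B" "p \<noteq> q" "q \<noteq> B" "q \<noteq> C" "r \<noteq> C" "r \<noteq> D" "r \<noteq> q"
    unfolding col
    using n adj[of 2 1 3] adj[of 1 2 3] adj[of 1 2 4] adj[of 4 2 3] adj[of 2 4 3] adj[of 5 4 3]
      adj[of 4 5 3] adj[of 5 4 2]
    by (simp_all add: insert_commute)
  have "card ({..<5} - {A, B, C, D}) = 1"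
    using lt5 ABCD by (subst card_Diff_subset) auto
  then obtain E where "{..<5} - {A, B, C, D} = {E}"
    using card_1_singletonE by blast
  then have "{..<5} \<subseteq> {A, B, C, D, E}" by blast
  then have five: "p \<in> {A, B, C, D, E}" "q \<in> {A, B, C, D, E}" "r \<in> {A, B, C, D, E}"
    using lt5 by blast+
  from five(2) pqr consider "q = E" | "q = A" | "q = D" by blast
  then show False
  proof cases
    case 1
    then have "p = C \<or> p = D" "r = A \<or> r = B" using five pqr by blast+
    moreover have "\<not> (p = C \<and> B = r)" "\<not> (p = C \<and> A = r)" "\<not> (p = D \<and> A = r)" "\<not> (p = D \<and> B = r)"
      unfolding col
      using n alt[of 1 2 3 4 5] alt[of 2 1 3 4 5] alt[of 2 1 3 5 4] alt[of 1 2 3 5 4]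
      by (simp_all add: insert_commute)
    ultimately show False by blast
  next
    case 2
    have "\<not> (A = q \<and> B = r)" "\<not> (A = q \<and> p = r)" "\<not> (A = q \<and> p = C)" "\<not> (q = A \<and> p = D)"
      unfolding col
      using n alt[of 1 3 2 4 5] alt[of 3 1 2 4 5] alt[of 3 1 2 4 3] alt[of 4 2 1 3 5]
      by (simp_all add: insert_commute)
    then show False using 2 five pqr by blast
  next
    case 3
    have "\<not> (D = q \<and> C = p)" "\<not> (D = q \<and> r = p)" "\<not> (D = q \<and> r = B)" "\<not> (q = D \<and> r = A)"
      unfolding col
      using n alt[of 5 3 4 2 1] alt[of 3 5 4 2 1] alt[of 3 5 4 2 3] alt[of 2 4 5 3 1]
      by (simp_all add: insert_commute)
    then show False using 3 five pqr by blast
  qed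
qed

section \<open>Colouring by vertex sums on three and four vertices\<close>

text \<open>Adjacent edges have sums that differ by less than \<open>n\<close>. A trail with four distinct vertices
  needs \<open>n = 4\<close>; it is then a cycle through all the vertices, whose numbers have sum \<open>10\<close>. If
  opposite edges have equal colours, all edges have odd sums. The vertices on the cycle then alternate
  in parity, and \<open>1\<close> and \<open>4\<close> would be neighbours on it, although they are not adjacent.\<close>

lemma sum_mod_coloring_small:
  assumes n: "n = 3 \<or> n = 4"
  shows "star_edge_coloring (graph_square (path_graph n)) n (\<lambda>e. \<Sum>e mod n)"
proof -
  have pair: "\<Sum>{u, v} = u + v" if "u \<noteq> v" for u v :: nat
    using that by simp
  have adj: "\<Sum>{u, v} mod n \<noteq> \<Sum>{v, w} mod n"
    if V: "{u, v, w} \<subseteq> {1..n}" and e: "near u v" "near v w" "u \<noteq> w" for u v w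
  proof -
    have "u \<in> {1, 2, 3, 4}" "v \<in> {1, 2, 3, 4}" "w \<in> {1, 2, 3, 4}"
      using V n by auto
    then have "(u + v) mod 4 \<noteq> (v + w) mod 4"
      using e(3) by (elim insertE emptyE; hypsubst; simp)
    moreover have "(u + v) mod 3 \<noteq> (v + w) mod 3" if "n = 3"
    proof -
      have "u \<in> {1, 2, 3}" "v \<in> {1, 2, 3}" "w \<in> {1, 2, 3}"
        using V that by auto
      then show ?thesis
        using e(3) by (elim insertE emptyE; hypsubst; simp)
    qed
    ultimately show ?thesis using n e pair by metis
  qed
  have alt: "\<not> (\<Sum>{u, v} mod n = \<Sum>{w, x} mod n \<and> \<Sum>{v, w} mod n = \<Sum>{x, y} mod n)"
    if sub: "{u, v, w, x, y} \<subseteq> {1..n}" and near: "near u v" "near v w" "near w x" "near x y"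
      and d: "distinct [u, v, w, x]" "y \<notin> {v, w, x}" for u v w x y
  proof -
    have card: "card {u, v, w, x} = 4" using d by auto
    moreover have "card {u, v, w, x} \<le> card {1..n}" using sub by (intro card_mono) auto
    ultimately have n4: "n = 4" using n by auto
    then have all: "{u, v, w, x} = {1..4}" using sub card by (intro card_subset_eq) auto
    then have yu: "y = u" using sub d n4 by blast
    have "\<Sum>{u, v, w, x} = 10" unfolding all by (simp add: eval_nat_numeral)
    then have total: "u + v + w + x = 10" using d by simp
    have odd: "odd s" if "s + t = 10" "s mod 4 = t mod 4" for s t :: nat
    proof
      assume "even s"
      with that(1) have "even t" by (metis even_add even_numeral)
      with \<open>even s\<close> obtain a b where ab: "s = 2 * a" "t = 2 * b" by (elim evenE)
      have "2 * a mod (2 * 2) = 2 * b mod (2 * 2)" using that(2) unfolding ab by simp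
      then have "a mod 2 = b mod 2" unfolding mod_mult_mult1 by simp
      then have "even (a + b)" by (metis even_add even_iff_mod_2_eq_zero)
      moreover have "a + b = 5" using that(1) unfolding ab by simp
      ultimately show False by simp
    qed
    show ?thesis
    proof
      assume "\<Sum>{u, v} mod n = \<Sum>{w, x} mod n \<and> \<Sum>{v, w} mod n = \<Sum>{x, y} mod n"
      then have "(u + v) mod 4 = (w + x) mod 4" "(v + w) mod 4 = (x + u) mod 4"
        using d near pair unfolding n4 yu by metis+
      then have "odd (u + v)" "odd (v + w)"
        using total by (intro odd[of _ "w + x"] odd[of _ "x + u"]; simp)+
      moreover from this have "odd (w + x)" using total
        by (metis even_add even_numeral group_cancel.add1 odd)
      moreover have "1 \<in> {u, v, w, x}" "4 \<in> {u, v, w, x}" unfolding all by simp_all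
      ultimately show False using near unfolding yu by auto
    qed
  qed
  have less: "\<Sum>{u, v} mod n < n" for u v using n by auto
  show ?thesis
    unfolding star_edge_coloring_square_path_iff
  proof (intro conjI allI impI, goal_cases)
    case (1 u v)
    show ?case by (rule less)
  next
    case (2 u v w)
    then show ?case by (intro adj) simp_all
  next
    case (3 u v w x y)
    then show ?case by (intro alt) simp_all
  qed
qed

section \<open>The ladder colouring\<close>

text \<open>The three branches are the rungs, the diagonals and the rails. Rails and diagonals of layer \<open>j\<close>
  take only colours of the parity of \<open>j\<close>, so consecutive layers share no colour; the shift by two
  separates a diagonal from the rails of its own layer.\<close>

definition ladder_color :: "nat set \<Rightarrow> nat" where
  "ladder_color e = (let u = Min e; v = Max e; j = u div 2 in
     if v div 2 = j then 4 + j mod 2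
     else if v = u + 1 then (j + 2) mod 4
     else j mod 4)"

lemma ladder_color_eq:
  "u < v \<Longrightarrow> ladder_color {u, v} =
     (if v div 2 = u div 2 then 4 + u div 2 mod 2
      else if v = u + 1 then (u div 2 + 2) mod 4 else u div 2 mod 4)"
  by (simp add: ladder_color_def Let_def)

lemma ladder_color_periodic:
  assumes "u < v"
  shows "ladder_color {u + 8, v + 8} = ladder_color {u, v}"
proof -
  have d: "(w + 8) div 2 = w div 2 + 4" for w :: nat by simp
  have m: "(j + 4) mod 2 = j mod 2" "(j + 4) mod 4 = j mod 4" "(j + 4 + 2) mod 4 = (j + 2) mod 4"
    for j :: nat
    using mod_add_self2[of "j + 2" 4] mod_mult_self1[of j 2 2]
    by (simp_all add: add.commute add.left_commute)
  have h: "v + 8 = u + 8 + 1 \<longleftrightarrow> v = u + 1" by linarith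
  have "ladder_color {u + 8, v + 8} =
     (if (v + 8) div 2 = (u + 8) div 2 then 4 + (u + 8) div 2 mod 2
      else if v + 8 = u + 8 + 1 then ((u + 8) div 2 + 2) mod 4 else (u + 8) div 2 mod 4)"
    by (rule ladder_color_eq) (use assms in linarith)
  also have "\<dots> = ladder_color {u, v}"
    unfolding ladder_color_eq[OF assms] d m h by (simp only: add_right_cancel)
  finally show ?thesis .
qed

text \<open>Periodicity reduces the claim to the finitely many pairs of edges with \<open>u < 8\<close>. The first
  alternative is the pair of rails of one layer. In the second, one edge is a diagonal and the
  other a rail, two layers apart.\<close>

lemma ladder_color_eq_sorted:
  assumes uv: "u < v" "v \<le> u + 2" and xy: "x < y" "y \<le> x + 2"
    and ux: "u \<le> x" "x \<le> v + 2" and ne: "(u, v) \<noteq> (x, y)"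
    and eq: "ladder_color {u, v} = ladder_color {x, y}"
  shows "even u \<and> v = u + 2 \<and> x = u + 1 \<and> y = u + 3 \<or>
    odd u \<and> x = v + 2 \<and> y = u + 5"
  using assms
proof (induction u arbitrary: v x y rule: less_induct)
  case (less u)
  show ?case
  proof (cases "u < 8")
    case True
    then have u: "u = 0 \<or> u = 1 \<or> u = 2 \<or> u = 3 \<or> u = 4 \<or> u = 5 \<or> u = 6 \<or> u = 7"
      by linarith
    have v: "v = u + 1 \<or> v = u + 2" and y: "y = x + 1 \<or> y = x + 2"
      using less.prems by linarith+
    have x: "x = u \<or> x = u + 1 \<or> x = u + 2 \<or> x = u + 3 \<or> x = u + 4"
      using less.prems by linarith
    from u v x y less.prems(6-8) show ?thesis
      by (elim disjE; hypsubst; simp add: ladder_color_eq)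
  next
    case False
    define u' v' x' y' where defs: "u' = u - 8" "v' = v - 8" "x' = x - 8" "y' = y - 8"
    have shift: "u = u' + 8" "v = v' + 8" "x = x' + 8" "y = y' + 8"
      using False less.prems unfolding defs by linarith+
    have "even u' \<and> v' = u' + 2 \<and> x' = u' + 1 \<and> y' = u' + 3 \<or>
        odd u' \<and> x' = v' + 2 \<and> y' = u' + 5"
    proof (rule less.IH)
      show "ladder_color {u', v'} = ladder_color {x', y'}"
        using less.prems unfolding shift by (simp only: ladder_color_periodic add_less_cancel_right)
    qed (use less.prems in \<open>simp_all add: shift\<close>)
    then show ?thesis by (elim disjE) (simp_all add: shift)
  qed
qed

text \<open>The edges are now listed in the order and direction in which a trail traverses them, with a
  connecting edge from \<open>b\<close> to \<open>c\<close>, or with \<open>b = c\<close>. The last two alternatives are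
  the rising and the falling trail.\<close>

lemma ladder_color_eq_joined:
  assumes ab: "near a b" and cd: "near c d" and bc: "b \<le> c + 2" "c \<le> b + 2"
    and ne: "{a, b} \<noteq> {c, d}" and eq: "ladder_color {a, b} = ladder_color {c, d}"
  shows "(\<exists>k. even k \<and> ({a, b} = {k, k + 2} \<and> {c, d} = {k + 1, k + 3} \<or>
                      {a, b} = {k + 1, k + 3} \<and> {c, d} = {k, k + 2})) \<or>
    odd a \<and> (b = a + 1 \<or> b = a + 2) \<and> c = b + 2 \<and> d = a + 5 \<or>
    odd d \<and> (c = d + 1 \<or> c = d + 2) \<and> b = c + 2 \<and> a = d + 5"
proof -
  have sorted: "{p, q} = {min p q, max p q}" for p q :: nat
    by (auto simp: min_def max_def)
  have lt: "min a b < max a b" "max a b \<le> min a b + 2" "min c d < max c d" "max c d \<le> min c d + 2"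
    using ab cd by linarith+
  have ne': "(min a b, max a b) \<noteq> (min c d, max c d)"
    using ne sorted by (metis prod.inject)
  have eq': "ladder_color {min a b, max a b} = ladder_color {min c d, max c d}"
    using eq sorted by metis
  show ?thesis
  proof (cases "min a b \<le> min c d")
    case True
    have "even (min a b) \<and> max a b = min a b + 2 \<and> min c d = min a b + 1 \<and> max c d = min a b + 3 \<or>
      odd (min a b) \<and> min c d = max a b + 2 \<and> max c d = min a b + 5"
      by (rule ladder_color_eq_sorted[OF lt])
        (use lt True bc in linarith, use lt True bc in linarith, fact ne', fact eq')
    then show ?thesis
    proof
      assume "even (min a b) \<and> max a b = min a b + 2 \<and> min c d = min a b + 1 \<and> max c d = min a b + 3"
      then show ?thesis using sorted[of a b] sorted[of c d] by metis
    next
      assume up: "odd (min a b) \<and> min c d = max a b + 2 \<and> max c d = min a b + 5"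
      then have "c = min c d" "b = max a b" using bc by linarith+
      moreover from this have "a = min a b" "d = max c d" using lt by linarith+
      moreover have "max a b = min a b + 1 \<or> max a b = min a b + 2" using lt by linarith
      ultimately show ?thesis using up by metis
    qed
  next
    case False
    have "even (min c d) \<and> max c d = min c d + 2 \<and> min a b = min c d + 1 \<and> max a b = min c d + 3 \<or>
      odd (min c d) \<and> min a b = max c d + 2 \<and> max a b = min c d + 5"
      by (rule ladder_color_eq_sorted[OF lt(3,4,1,2)])
        (use lt False bc in linarith, use lt False bc in linarith, fact ne'[symmetric],
          fact eq'[symmetric])
    then show ?thesis
    proof
      assume "even (min c d) \<and> max c d = min c d + 2 \<and> min a b = min c d + 1 \<and> max a b = min c d + 3"
      then show ?thesis using sorted[of a b] sorted[of c d] by metis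
    next
      assume down: "odd (min c d) \<and> min a b = max c d + 2 \<and> max a b = min c d + 5"
      then have "b = min a b" "c = max c d" using bc by linarith+
      moreover from this have "d = min c d" "a = max a b" using lt by linarith+
      moreover have "max c d = min c d + 1 \<or> max c d = min c d + 2" using lt by linarith
      ultimately show ?thesis using down by metis
    qed
  qed
qed

text \<open>Both alternatives in which a trail is monotone have a gap of two between the edges, and the two
  rails of a layer are disjoint.\<close>

lemma ladder_color_proper:
  assumes "near u v" "near v w" "u \<noteq> w"
  shows "ladder_color {u, v} \<noteq> ladder_color {v, w}"
proof
  assume eq: "ladder_color {u, v} = ladder_color {v, w}"
  have ne: "{u, v} \<noteq> {v, w}" using assms(3) by (auto simp: doubleton_eq_iff)
  consider k where "{u, v} = {k, k + 2} \<and> {v, w} = {k + 1, k + 3} \<or>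
      {u, v} = {k + 1, k + 3} \<and> {v, w} = {k, k + 2}" | "v = v + 2"
    using ladder_color_eq_joined[OF assms(1,2) le_add1 le_add1 ne eq] by metis
  then show False
  proof cases
    case 1
    then have "v \<in> {k, k + 2}" "v \<in> {k + 1, k + 3}" by (metis insertCI)+
    then show False by auto
  qed simp
qed

lemma ladder_color_no_bicolored_trail:
  assumes near: "near u v" "near v w" "near w x" "near x y"
    and distinct: "distinct [u, v, w, x]" "y \<notin> {v, w, x}"
  shows "\<not> (ladder_color {u, v} = ladder_color {w, x} \<and> ladder_color {v, w} = ladder_color {x, y})"
proof
  assume eq: "ladder_color {u, v} = ladder_color {w, x} \<and> ladder_color {v, w} = ladder_color {x, y}"
  have "{u, v} \<noteq> {w, x}" "{v, w} \<noteq> {x, y}"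
    using distinct by (auto simp: doubleton_eq_iff)
  have first: "(\<exists>k. even k \<and> ({u, v} = {k, k + 2} \<and> {w, x} = {k + 1, k + 3} \<or>
                      {u, v} = {k + 1, k + 3} \<and> {w, x} = {k, k + 2})) \<or>
      odd u \<and> (v = u + 1 \<or> v = u + 2) \<and> w = v + 2 \<and> x = u + 5 \<or>
      odd x \<and> (w = x + 1 \<or> w = x + 2) \<and> v = w + 2 \<and> u = x + 5" (is "?par1 \<or> ?up1 \<or> ?down1")
    using ladder_color_eq_joined[of u v w x] near eq \<open>{u, v} \<noteq> {w, x}\<close> by blast
  have second: "(\<exists>k. even k \<and> ({v, w} = {k, k + 2} \<and> {x, y} = {k + 1, k + 3} \<or>
                      {v, w} = {k + 1, k + 3} \<and> {x, y} = {k, k + 2})) \<or>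
      odd v \<and> (w = v + 1 \<or> w = v + 2) \<and> x = w + 2 \<and> y = v + 5 \<or>
      odd y \<and> (x = y + 1 \<or> x = y + 2) \<and> w = x + 2 \<and> v = y + 5" (is "?par2 \<or> ?up2 \<or> ?down2")
    using ladder_color_eq_joined[of v w x y] near eq \<open>{v, w} \<noteq> {x, y}\<close> by blast
  \<comment> \<open>If both patterns rise, then \<open>u\<close> and \<open>v\<close> are odd, so \<open>uv\<close> is a rail and \<open>wx\<close> must be a diagonal;
    but \<open>wx\<close> connects the edges of the second pattern, so it has length two. If both fall, reverse
    the trail. The inequalities below separate the remaining combinations.\<close>
  have par1D: "even v \<noteq> even w" "odd v \<Longrightarrow> v < w \<Longrightarrow> x < w" "even v \<Longrightarrow> v \<le> x + 1" if ?par1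
    using that by (auto simp: doubleton_eq_iff)
  have up1D: "v < w" "w = v + 2" "even v \<Longrightarrow> x = v + 4" "odd v \<Longrightarrow> x = v + 3" if ?up1
    using that by auto
  have down1D: "w < v" "v = w + 2" "even w \<Longrightarrow> w = x + 1" "odd w \<Longrightarrow> w = x + 2" if ?down1
    using that by auto
  have par2D: "even v \<longleftrightarrow> even w" "v < w \<Longrightarrow> x \<le> v + 3" "v < w \<Longrightarrow> odd v \<Longrightarrow> x \<le> v + 1"
    "w < v \<Longrightarrow> even w \<Longrightarrow> w < x" "w < v \<Longrightarrow> odd w \<Longrightarrow> w \<le> x + 1" if ?par2
    using that by (auto simp: doubleton_eq_iff)
  have up2D: "odd v" "v < w" "x = w + 2" if ?up2
    using that by auto
  have down2D: "even v" "w < v" "w = x + 2" "x + 3 \<le> v" if ?down2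
    using that by auto
  from first show False
  proof (elim disjE)
    assume 1: ?par1
    show False using second par1D[OF 1] par2D(1) up2D down2D by (elim disjE) (metis, force, force)
  next
    assume 1: ?up1
    show False using second
    proof (elim disjE)
      assume 2: ?par2
      show False using up1D[OF 1] par2D[OF 2] by (cases "even v") linarith+
    next
      assume 2: ?up2
      show False using up1D[OF 1] up2D[OF 2] by linarith
    next
      assume 2: ?down2
      show False using up1D[OF 1] down2D[OF 2] by linarith
    qed
  next
    assume 1: ?down1
    show False using second
    proof (elim disjE)
      assume 2: ?par2
      show False using down1D[OF 1] par2D[OF 2] by (cases "even w") linarith+
    next
      assume 2: ?up2
      show False using down1D[OF 1] up2D[OF 2] by linarith
    next
      assume 2: ?down2
      then have "even w" using down1D[OF 1] down2D[OF 2] by simp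
      then show False using down1D[OF 1] down2D[OF 2] by linarith
    qed
  qed
qed

lemma ladder_color_star_edge_coloring:
  "star_edge_coloring (graph_square (path_graph n)) 6 ladder_color"
proof -
  have "j mod 4 < 6" for j :: nat
    by (rule less_le_trans[OF mod_less_divisor]) simp_all
  moreover have "4 + j mod 2 < 6" for j :: nat
    using add_strict_left_mono[OF mod_less_divisor[of 2 j], of 4]
    by (simp only: numeral_plus_numeral add_num_simps zero_less_numeral simp_thms)
  ultimately have less: "ladder_color e < 6" for e
    unfolding ladder_color_def Let_def by (simp only: simp_thms split: if_split)
  show ?thesis
    unfolding star_edge_coloring_square_path_iff
  proof (intro conjI allI impI, goal_cases)
    case (1 u v)
    show ?case by (rule less)
  next
    case (2 u v w)
    then show ?case by (intro ladder_color_proper) simp_all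
  next
    case (3 u v w x y)
    then show ?case by (intro ladder_color_no_bicolored_trail) simp_all
  qed
qed

section \<open>The star chromatic index\<close>

lemma star_chromatic_index_eqI:
  assumes "star_edge_coloring G k c" and "\<And>k' c'. star_edge_coloring G k' c' \<Longrightarrow> k \<le> k'"
  shows "star_chromatic_index G = k"
  unfolding star_chromatic_index_def using assms by (blast intro: Least_equality)

theorem theorem3p1:
  fixes n :: nat
  assumes "n \<ge> 3"
  shows "star_chromatic_index (graph_square (path_graph n)) =
           (if n = 3 then 3 else if n = 4 then 4 else 6)"
proof -
  consider "n = 3" | "n = 4" | "n \<ge> 5" using assms by linarith
  then show ?thesis
  proof cases
    case 1
    have "star_chromatic_index (graph_square (path_graph n)) = n"
      using sum_mod_coloring_small[of n] triangle_needs_three_colors[of n] 1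
      by (intro star_chromatic_index_eqI) simp_all
    then show ?thesis using 1 by simp
  next
    case 2
    have "star_chromatic_index (graph_square (path_graph n)) = n"
      using sum_mod_coloring_small[of n] four_vertices_need_four_colors[of n] 2
      by (intro star_chromatic_index_eqI) simp_all
    then show ?thesis using 2 by simp
  next
    case 3
    have "star_chromatic_index (graph_square (path_graph n)) = 6"
      using ladder_color_star_edge_coloring five_vertices_need_six_colors[OF 3]
      by (rule star_chromatic_index_eqI)
    then show ?thesis using 3 by simp
  qed
qed

end
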